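(* Let $\gamma$ be a modulus function. Then the space $(\mathbb{R},\tau_\gamma)$, where $\tau_\gamma$ is the modulus density topology, is not metrizable.
   Context: $|\cdot|$ denotes Lebesgue measure on $\mathbb{R}$, $\mathcal{L}$ the family of Lebesgue measurable subsets of $\mathbb{R}$, and $A^c=\mathbb{R}\setminus A$. A modulus function is a function $\gamma:[0,\infty)\to[0,\infty)$ such that (i) $\gamma(a)=0\Leftrightarrow a=0$; (ii) $\gamma(a+b)\le\gamma(a)+\gamma(b)$ for all $a,b\ge 0$; (iii) $\gamma$ is right-continuous at $0$; (iv) $\gamma$ is increasing (in the weak sense: $a\le b$ implies $\gamma(a)\le\gamma(b)$). For $A\in\mathcal{L}$, $\mathcal{D}_\gamma(A)$ is the set of all $x\in\mathbb{R}$ with $\lim_{\alpha\to 0^+}\frac{\gamma(|(x-\alpha,x+\alpha)\cap A^c|)}{\gamma(2\alpha)}=0$. The modulus density topology on $\mathbb{R}$ is $\tau_\gamma=\{A\in\mathcal{L}:A\subset\mathcal{D}_\gamma(A)\}$. *)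

theory Defs
  imports "HOL-Analysis.Analysis"
begin

text \<open>
  A modulus function maps $[0,\infty)$ to itself. It is represented by a total function on the
  reals that is constrained on the nonnegative reals only; its values at negative arguments are
  arbitrary and never used below.
\<close>

definition modulus_function :: "(real \<Rightarrow> real) \<Rightarrow> bool" where
  "modulus_function \<gamma> \<longleftrightarrow>
     \<gamma> \<in> {0..} \<rightarrow> {0..} \<and>
     (\<forall>a\<ge>0. \<gamma> a = 0 \<longleftrightarrow> a = 0) \<and>
     (\<forall>a\<ge>0. \<forall>b\<ge>0. \<gamma> (a + b) \<le> \<gamma> a + \<gamma> b) \<and>
     continuous (at_right 0) \<gamma> \<and>
     mono_on {0..} \<gamma>"

definition modulus_density_points :: "(real \<Rightarrow> real) \<Rightarrow> real set \<Rightarrow> real set" where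
  "modulus_density_points \<gamma> A =
     {x. ((\<lambda>\<alpha>. \<gamma> (measure lebesgue ({x - \<alpha><..<x + \<alpha>} \<inter> - A)) / \<gamma> (2 * \<alpha>)) \<longlongrightarrow> 0)
           (at_right 0)}"

definition modulus_density_open :: "(real \<Rightarrow> real) \<Rightarrow> real set \<Rightarrow> bool" where
  "modulus_density_open \<gamma> A \<longleftrightarrow> A \<in> sets lebesgue \<and> A \<subseteq> modulus_density_points \<gamma> A"

text \<open>
  For a modulus function these sets do form a topology. Subadditivity and monotonicity make every
  such set open in the classical density topology, so arbitrary unions are again Lebesgue
  measurable. For other functions the next definition is not meaningful.
\<close>

definition modulus_density_topology :: "(real \<Rightarrow> real) \<Rightarrow> real topology" where
  "modulus_density_topology \<gamma> = topology (modulus_density_open \<gamma>)"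

end

theory Submission
  imports Defs
begin

text \<open>
  Two features of \<open>\<tau>\<^sub>\<gamma>\<close> contradict each other in a metrizable space. Complements of null sets are
  open, because \<open>\<gamma> 0 = 0\<close>, so every countable set is closed. In a first-countable space this
  makes every point isolated: choosing in each basic neighbourhood of a non-isolated \<open>x\<close> a point
  other than \<open>x\<close> gives a countable set whose complement is a neighbourhood of \<open>x\<close> containing none
  of the basic ones (lemma \<open>first_countable_closedin_countable_imp_openin_singleton\<close>). But no
  point is isolated in \<open>\<tau>\<^sub>\<gamma>\<close>, because a singleton misses almost all of every interval. So
  \<open>\<tau>\<^sub>\<gamma>\<close> is not even first countable.

  Most of the work is to see that \<open>\<tau>\<^sub>\<gamma>\<close> is a topology at all, that is, that an uncountable union
  of its members is Lebesgue measurable. Subadditivity gives \<open>\<gamma> (n * a) \<le> n * \<gamma> a\<close>, so a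
  complement that takes a fixed proportion of an interval still does so after \<open>\<gamma>\<close> is applied; hence a
  \<open>\<gamma>\<close>-density point is an ordinary density point (lemma \<open>density_of_modulus_density_point\<close>). For
  sets all of whose points are density points, the Vitali covering theorem selects countably many
  disjoint balls that cover almost all of the union, each of them nearly filled by one member of
  the family; the parts filled in this way exhaust the union up to a null set (lemma
  \<open>sets_lebesgue_Union_density\<close>).
\<close>

section \<open>Unions of sets with full density at their points\<close>

text \<open>
  Around each point of the bounded part of the union there are arbitrarily small balls of which
  some member of \<open>\<A>\<close> containing the centre misses only a fraction \<open>e'\<close>. The Vitali covering
  theorem extracts countably many disjoint ones that cover up to a null set. Let \<open>V\<close> collect, in
  each chosen ball, the part inside the chosen member. What is lost is a null set together with a
  fraction \<open>e'\<close> of each ball, and by disjointness the balls have bounded total measure.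
\<close>

lemma Union_density_inner_approx:
  fixes \<A> :: "'a::euclidean_space set set"
  assumes meas: "\<And>A. A \<in> \<A> \<Longrightarrow> A \<in> sets lebesgue"
    and dens: "\<And>A x e. \<lbrakk>A \<in> \<A>; x \<in> A; e > 0\<rbrakk> \<Longrightarrow>
      \<forall>\<^sub>F r in at_right 0. measure lebesgue (ball x r - A) \<le> e * measure lebesgue (ball x r)"
    and "e > 0" "R > 0"
  obtains V T where "V \<in> sets lebesgue" "V \<subseteq> \<Union>\<A>"
    "\<Union>\<A> \<inter> ball 0 R - V \<subseteq> T" "T \<in> lmeasurable" "measure lebesgue T \<le> e"
proof -
  let ?\<mu> = "measure (lebesgue :: 'a measure)"
  \<comment> \<open>Balls of radius at most 1 centred in \<open>ball 0 R\<close> stay inside \<open>ball 0 (R + 1)\<close>, so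
    losing a fraction \<open>e'\<close> of each of a disjoint family of them costs at most \<open>e\<close> in total.\<close>
  define e' where "e' = e / ?\<mu> (ball 0 (R + 1))"
  have pos: "?\<mu> (ball 0 (R + 1)) > 0"
    using \<open>R > 0\<close> by simp
  then have "e' > 0"
    using \<open>e > 0\<close> by (simp add: e'_def)
  \<comment> \<open>A Vitali index records, besides centre and radius, the member of \<open>\<A>\<close> that nearly fills
    the ball, so that a countable choice of balls is also a countable choice of members.\<close>
  define K where "K = {(x :: 'a, r, A). x \<in> ball 0 R \<and> A \<in> \<A> \<and> r \<le> 1 \<and>
      ?\<mu> (ball x r - A) \<le> e' * ?\<mu> (ball x r)}"
  define b where "b i = ball (fst i) (fst (snd i))" for i :: "'a \<times> real \<times> 'a set"
  define S where "S = \<Union>\<A> \<inter> ball 0 R"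
  have fine: "\<exists>i. i \<in> K \<and> x \<in> ball (fst i) (fst (snd i)) \<and> fst (snd i) < d"
    if "x \<in> S" "d > 0" for x d
  proof -
    obtain A where A: "A \<in> \<A>" "x \<in> A" "x \<in> ball 0 R"
      using \<open>x \<in> S\<close> by (auto simp: S_def)
    have "\<forall>\<^sub>F r in at_right (0::real). r > 0 \<and> r < min d 1"
      using \<open>d > 0\<close> by (auto simp: eventually_at_right_field intro!: exI[of _ "min d 1"])
    with dens[OF A(1,2) \<open>e' > 0\<close>]
    have "\<forall>\<^sub>F r in at_right 0. (r > 0 \<and> r < min d 1) \<and> ?\<mu> (ball x r - A) \<le> e' * ?\<mu> (ball x r)"
      by (simp add: eventually_conj_iff)
    then obtain r where "r > 0" "r < min d 1" "?\<mu> (ball x r - A) \<le> e' * ?\<mu> (ball x r)"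
      using eventually_happens'[OF trivial_limit_at_right_real] by blast
    then show ?thesis
      using A by (intro exI[of _ "(x, r, A)"]) (auto simp: K_def)
  qed
  obtain C where C: "countable C" "C \<subseteq> K"
    and disj: "pairwise (\<lambda>i j. disjnt (b i) (b j)) C"
    and neg: "negligible (S - (\<Union>i \<in> C. b i))"
    by (rule Vitali_covering_theorem_balls[OF fine, folded b_def])
  have A_sets: "snd (snd i) \<in> sets lebesgue" if "i \<in> C" for i
    using that C meas by (auto simp: K_def)
  have b_meas: "b i \<in> lmeasurable" for i
    by (simp add: b_def)
  have rest_meas: "b i - snd (snd i) \<in> lmeasurable" if "i \<in> C" for i
    using that A_sets b_meas by (intro fmeasurable_Diff) auto
  have bound: "?\<mu> (\<Union>i\<in>I. b i - snd (snd i)) \<le> e" if I: "I \<subseteq> C" "finite I" for I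
  proof -
    have "?\<mu> (\<Union>i\<in>I. b i - snd (snd i)) \<le> (\<Sum>i\<in>I. ?\<mu> (b i - snd (snd i)))"
      using I rest_meas by (intro measure_UNION_le) auto
    also have "\<dots> \<le> (\<Sum>i\<in>I. e' * ?\<mu> (b i))"
      using I C by (intro sum_mono) (auto simp: K_def b_def)
    also have "\<dots> = e' * ?\<mu> (\<Union>i\<in>I. b i)"
      using I disj b_meas
      by (subst measure_UNION') (auto simp: sum_distrib_left intro: pairwise_subset)
    also have "\<dots> \<le> e' * ?\<mu> (ball 0 (R + 1))"
    proof (intro mult_left_mono measure_mono_fmeasurable)
      show "(\<Union>i\<in>I. b i) \<subseteq> ball 0 (R + 1)"
      proof (intro UN_least)
        fix i assume "i \<in> I"
        then have "fst i \<in> ball 0 R" "fst (snd i) \<le> 1"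
          using I C by (auto simp: K_def)
        then show "b i \<subseteq> ball 0 (R + 1)"
          unfolding b_def by (simp add: ball_subset_ball_iff)
      qed
      show "(\<Union>i\<in>I. b i) \<in> sets lebesgue"
        using I b_meas by (intro sets.finite_UN) auto
    qed (use \<open>e' > 0\<close> in auto)
    also have "\<dots> = e"
      using pos by (simp add: e'_def)
    finally show ?thesis .
  qed
  let ?V = "\<Union>i\<in>C. b i \<inter> snd (snd i)"
  let ?D = "\<Union>i\<in>C. b i - snd (snd i)"
  let ?N = "S - (\<Union>i \<in> C. b i)"
  show thesis
  proof (rule that[of ?V "?N \<union> ?D"])
    show "?V \<in> sets lebesgue"
      using C A_sets b_meas by (intro sets.countable_UN' sets.Int) auto
    show "?V \<subseteq> \<Union>\<A>"
    proof
      fix x assume "x \<in> ?V"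
      then obtain i where "i \<in> C" "x \<in> snd (snd i)" by blast
      moreover from this have "snd (snd i) \<in> \<A>"
        using C by (auto simp: K_def)
      ultimately show "x \<in> \<Union>\<A>" by blast
    qed
    show "\<Union>\<A> \<inter> ball 0 R - ?V \<subseteq> ?N \<union> ?D"
      by (auto simp: S_def)
    have D: "?D \<in> lmeasurable" "?\<mu> ?D \<le> e"
      using fmeasurable_UN_bound[OF C(1) rest_meas bound]
        measure_UN_bound[OF C(1) rest_meas bound] by auto
    show "?N \<union> ?D \<in> lmeasurable"
      by (rule fmeasurable.Un[OF negligible_imp_measurable[OF neg] D(1)])
    have "?\<mu> (?N \<union> ?D) \<le> ?\<mu> ?N + ?\<mu> ?D"
      using neg D(1) by (intro measure_Un_le) (simp_all only: negligible_imp_sets fmeasurableD)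
    then show "?\<mu> (?N \<union> ?D) \<le> e"
      using D neg by (simp add: negligible_imp_measure0)
  qed
qed

text \<open>
  The countably many inner approximations, over growing balls and shrinking errors, leave only a
  null set of the union uncovered, and null sets are measurable in the completed measure.
\<close>

lemma sets_lebesgue_Union_density:
  fixes \<A> :: "'a::euclidean_space set set"
  assumes meas: "\<And>A. A \<in> \<A> \<Longrightarrow> A \<in> sets lebesgue"
    and dens: "\<And>A x e. \<lbrakk>A \<in> \<A>; x \<in> A; e > 0\<rbrakk> \<Longrightarrow>
      \<forall>\<^sub>F r in at_right 0. measure lebesgue (ball x r - A) \<le> e * measure lebesgue (ball x r)"
  shows "\<Union>\<A> \<in> sets lebesgue"
proof -
  have "\<exists>V. V \<in> sets lebesgue \<and> V \<subseteq> \<Union>\<A> \<and>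
      (\<exists>T. \<Union>\<A> \<inter> ball 0 (real n + 1) - V \<subseteq> T \<and> T \<in> lmeasurable \<and>
        measure lebesgue T \<le> inverse (real (Suc k)))" for n k
  proof -
    have "inverse (real (Suc k)) > 0" "real n + 1 > 0"
      by auto
    then obtain V T where "V \<in> sets lebesgue" "V \<subseteq> \<Union>\<A>"
        "\<Union>\<A> \<inter> ball 0 (real n + 1) - V \<subseteq> T" "T \<in> lmeasurable"
        "measure lebesgue T \<le> inverse (real (Suc k))"
      using Union_density_inner_approx[OF meas dens] by blast
    then show ?thesis by blast
  qed
  then obtain V where V: "\<And>n k. V n k \<in> sets lebesgue" "\<And>n k. V n k \<subseteq> \<Union>\<A>"
    and T: "\<And>n k. \<exists>T. \<Union>\<A> \<inter> ball 0 (real n + 1) - V n k \<subseteq> T \<and> T \<in> lmeasurable \<and>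
        measure lebesgue T \<le> inverse (real (Suc k))"
    by metis
  define W where "W = (\<Union>n k. V n k)"
  have "negligible (\<Union>\<A> \<inter> ball 0 (real n + 1) - W)" for n
    unfolding negligible_outer_le
  proof (intro allI impI)
    fix e :: real assume "e > 0"
    then obtain k where k: "inverse (real (Suc k)) < e"
      using reals_Archimedean by blast
    obtain T where T': "\<Union>\<A> \<inter> ball 0 (real n + 1) - V n k \<subseteq> T" "T \<in> lmeasurable"
        "measure lebesgue T \<le> inverse (real (Suc k))"
      using T[of n k] by blast
    have "V n k \<subseteq> W"
      unfolding W_def by blast
    then have "\<Union>\<A> \<inter> ball 0 (real n + 1) - W \<subseteq> T"
      using T'(1) by blast
    moreover have "measure lebesgue T \<le> e"
      using T'(3) k by linarith
    ultimately show "\<exists>T. \<Union>\<A> \<inter> ball 0 (real n + 1) - W \<subseteq> T \<and> T \<in> lmeasurable \<and>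
        measure lebesgue T \<le> e"
      using T'(2) by blast
  qed
  then have null: "(\<Union>n. \<Union>\<A> \<inter> ball 0 (real n + 1) - W) \<in> sets lebesgue"
    by (intro sets.countable_UN) (auto intro: negligible_imp_sets)
  have "\<exists>n. x \<in> ball 0 (real n + 1)" for x :: 'a
  proof -
    obtain n where "norm x \<le> real n"
      using real_arch_simple by blast
    then have "norm x < real n + 1" by linarith
    then show ?thesis by auto
  qed
  moreover have "W \<subseteq> \<Union>\<A>"
    unfolding W_def using V(2) by (intro UN_least)
  ultimately have "\<Union>\<A> = W \<union> (\<Union>n. \<Union>\<A> \<inter> ball 0 (real n + 1) - W)"
    by blast
  moreover have "W \<in> sets lebesgue"
    unfolding W_def using V by (intro sets.countable_UN) auto
  ultimately show ?thesis
    using null by (metis sets.Un)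
qed

section \<open>The modulus density topology\<close>

lemma modulus_function_mult_le:
  assumes "modulus_function \<gamma>" "a \<ge> 0"
  shows "\<gamma> (real n * a) \<le> real n * \<gamma> a"
proof (induction n)
  case 0
  then show ?case using assms by (auto simp: modulus_function_def)
next
  case (Suc n)
  have "\<gamma> (real n * a + a) \<le> \<gamma> (real n * a) + \<gamma> a"
    using assms by (auto simp: modulus_function_def)
  with Suc show ?case by (simp add: algebra_simps)
qed

lemma modulus_function_mono:
  assumes "modulus_function \<gamma>" "0 \<le> a" "a \<le> b"
  shows "\<gamma> a \<le> \<gamma> b"
  using assms by (auto simp: modulus_function_def mono_on_def)

lemma modulus_function_pos:
  assumes "modulus_function \<gamma>" "0 < a"
  shows "\<gamma> a > 0"
  using assms by (force simp: modulus_function_def Pi_iff less_le)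

lemma modulus_function_nonneg:
  assumes "modulus_function \<gamma>" "0 \<le> a"
  shows "\<gamma> a \<ge> 0"
  using assms by (auto simp: modulus_function_def Pi_iff)

lemma mem_modulus_density_points_iff:
  "x \<in> modulus_density_points \<gamma> A \<longleftrightarrow>
     ((\<lambda>r. \<gamma> (measure lebesgue (ball x r - A)) / \<gamma> (2 * r)) \<longlongrightarrow> 0) (at_right 0)"
  by (simp add: modulus_density_points_def ball_eq_greaterThanLessThan Diff_eq)

lemma measure_ball_real: "r \<ge> 0 \<Longrightarrow> measure lebesgue (ball (x::real) r) = 2 * r"
  by (simp add: ball_eq_greaterThanLessThan)

text \<open>
  If \<open>A\<close> misses at least \<open>1 / n\<close> of an interval of length \<open>2 * r\<close>, then
  \<open>\<gamma> (2 * r) \<le> n * \<gamma> (2 * r / n)\<close> shows that the modulus ratio is at least \<open>1 / n\<close>. So a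
  modulus ratio that tends to 0 forces the ordinary ratio to tend to 0.
\<close>

lemma density_of_modulus_density_point:
  assumes \<gamma>: "modulus_function \<gamma>"
    and x: "x \<in> modulus_density_points \<gamma> A" and "e > 0"
  shows "\<forall>\<^sub>F r in at_right 0. measure lebesgue (ball x r - A) \<le> e * measure lebesgue (ball x r)"
proof -
  obtain k where k: "inverse (real (Suc k)) < e"
    using \<open>e > 0\<close> reals_Archimedean by blast
  have "\<forall>\<^sub>F r in at_right 0. \<gamma> (measure lebesgue (ball x r - A)) / \<gamma> (2 * r) < inverse (real (Suc k))"
    using x unfolding mem_modulus_density_points_iff by (rule order_tendstoD) auto
  moreover have "\<forall>\<^sub>F r in at_right (0::real). r > 0"
    by (rule eventually_at_right_less)
  ultimately show ?thesis
  proof eventually_elim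
    case (elim r)
    let ?m = "measure lebesgue (ball x r - A)"
    show ?case
    proof (rule ccontr)
      assume "\<not> ?thesis"
      then have "e * (2 * r) < ?m"
        using measure_ball_real[of r x] \<open>r > 0\<close> by (simp only: not_le less_imp_le)
      moreover have "2 * r * inverse (real (Suc k)) \<le> e * (2 * r)"
        using k \<open>r > 0\<close> by (subst mult.commute) (intro mult_right_mono, auto)
      ultimately have le: "2 * r * inverse (real (Suc k)) \<le> ?m"
        by linarith
      have "0 \<le> 2 * r * inverse (real (Suc k))"
        using \<open>r > 0\<close> by simp
      then have m: "\<gamma> (2 * r * inverse (real (Suc k))) \<le> \<gamma> ?m"
        using le by (rule modulus_function_mono[OF \<gamma>])
      have "\<gamma> (2 * r) = \<gamma> (real (Suc k) * (2 * r * inverse (real (Suc k))))"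
        by (simp add: field_simps del: of_nat_Suc)
      also have "\<dots> \<le> real (Suc k) * \<gamma> (2 * r * inverse (real (Suc k)))"
        using \<open>r > 0\<close> by (intro modulus_function_mult_le[OF \<gamma>]) auto
      also have "\<dots> \<le> real (Suc k) * \<gamma> ?m"
        using m by (rule mult_left_mono) simp
      finally have "\<gamma> (2 * r) \<le> real (Suc k) * \<gamma> ?m" .
      moreover have "\<gamma> (2 * r) > 0"
        using \<open>r > 0\<close> by (simp add: modulus_function_pos[OF \<gamma>])
      then have "\<gamma> ?m < inverse (real (Suc k)) * \<gamma> (2 * r)"
        using elim(1) by (simp only: pos_divide_less_eq)
      then have "real (Suc k) * \<gamma> ?m < real (Suc k) * (inverse (real (Suc k)) * \<gamma> (2 * r))"
        by (rule mult_strict_left_mono) simp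
      moreover have "real (Suc k) * (inverse (real (Suc k)) * \<gamma> (2 * r)) = \<gamma> (2 * r)"
        by (simp del: of_nat_Suc)
      ultimately show False
        by linarith
    qed
  qed
qed

lemma modulus_density_points_mono:
  assumes \<gamma>: "modulus_function \<gamma>" and "A \<subseteq> B" "A \<in> sets lebesgue" "B \<in> sets lebesgue"
  shows "modulus_density_points \<gamma> A \<subseteq> modulus_density_points \<gamma> B"
proof
  fix x assume x: "x \<in> modulus_density_points \<gamma> A"
  show "x \<in> modulus_density_points \<gamma> B"
    unfolding mem_modulus_density_points_iff
  proof (rule tendsto_sandwich[OF _ _ tendsto_const x[unfolded mem_modulus_density_points_iff]])
    have "\<forall>\<^sub>F r in at_right (0::real). r > 0"
      by (rule eventually_at_right_less)
    then show "\<forall>\<^sub>F r in at_right 0. 0 \<le> \<gamma> (measure lebesgue (ball x r - B)) / \<gamma> (2 * r)"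
      by eventually_elim (auto intro!: divide_nonneg_nonneg modulus_function_nonneg[OF \<gamma>])
    show "\<forall>\<^sub>F r in at_right 0. \<gamma> (measure lebesgue (ball x r - B)) / \<gamma> (2 * r)
        \<le> \<gamma> (measure lebesgue (ball x r - A)) / \<gamma> (2 * r)"
      using \<open>\<forall>\<^sub>F r in at_right (0::real). r > 0\<close>
    proof eventually_elim
      case (elim r)
      have "measure lebesgue (ball x r - B) \<le> measure lebesgue (ball x r - A)"
        using assms by (intro measure_mono_fmeasurable fmeasurable_Diff) auto
      with elim show ?case
        by (intro divide_right_mono modulus_function_mono[OF \<gamma>] modulus_function_nonneg[OF \<gamma>]) auto
    qed
  qed
qed

lemma modulus_density_points_Int:
  assumes \<gamma>: "modulus_function \<gamma>" and "A \<in> sets lebesgue" "B \<in> sets lebesgue"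
  shows "modulus_density_points \<gamma> A \<inter> modulus_density_points \<gamma> B
    \<subseteq> modulus_density_points \<gamma> (A \<inter> B)"
proof
  fix x assume "x \<in> modulus_density_points \<gamma> A \<inter> modulus_density_points \<gamma> B"
  then have lim: "((\<lambda>r. \<gamma> (measure lebesgue (ball x r - A)) / \<gamma> (2 * r) +
      \<gamma> (measure lebesgue (ball x r - B)) / \<gamma> (2 * r)) \<longlongrightarrow> 0) (at_right 0)"
    unfolding mem_modulus_density_points_iff Int_iff by (auto intro: tendsto_add_zero)
  show "x \<in> modulus_density_points \<gamma> (A \<inter> B)"
    unfolding mem_modulus_density_points_iff
  proof (rule tendsto_sandwich[OF _ _ tendsto_const lim])
    have "\<forall>\<^sub>F r in at_right (0::real). r > 0"
      by (rule eventually_at_right_less)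
    then show "\<forall>\<^sub>F r in at_right 0. 0 \<le> \<gamma> (measure lebesgue (ball x r - A \<inter> B)) / \<gamma> (2 * r)"
      by eventually_elim (auto intro!: divide_nonneg_nonneg modulus_function_nonneg[OF \<gamma>])
    show "\<forall>\<^sub>F r in at_right 0. \<gamma> (measure lebesgue (ball x r - A \<inter> B)) / \<gamma> (2 * r)
        \<le> \<gamma> (measure lebesgue (ball x r - A)) / \<gamma> (2 * r) +
          \<gamma> (measure lebesgue (ball x r - B)) / \<gamma> (2 * r)"
      using \<open>\<forall>\<^sub>F r in at_right (0::real). r > 0\<close>
    proof eventually_elim
      case (elim r)
      let ?a = "measure lebesgue (ball x r - A)" and ?b = "measure lebesgue (ball x r - B)"
      have "measure lebesgue (ball x r - A \<inter> B) \<le> ?a + ?b"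
        unfolding Diff_Int using assms by (intro measure_Un_le sets.Diff) auto
      then have "\<gamma> (measure lebesgue (ball x r - A \<inter> B)) \<le> \<gamma> (?a + ?b)"
        by (intro modulus_function_mono[OF \<gamma>]) auto
      also have "\<dots> \<le> \<gamma> ?a + \<gamma> ?b"
        using \<gamma> by (simp add: modulus_function_def)
      finally show ?case
        using elim modulus_function_pos[OF \<gamma>, of "2 * r"]
        by (simp add: divide_right_mono flip: add_divide_distrib)
    qed
  qed
qed

lemma istopology_modulus_density_open:
  assumes \<gamma>: "modulus_function \<gamma>"
  shows "istopology (modulus_density_open \<gamma>)"
  unfolding istopology_def
proof (intro conjI allI impI)
  fix A B assume "modulus_density_open \<gamma> A" "modulus_density_open \<gamma> B"
  then show "modulus_density_open \<gamma> (A \<inter> B)"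
    using modulus_density_points_Int[OF \<gamma>, of A B] by (auto simp: modulus_density_open_def)
next
  fix \<A> assume \<A>: "\<forall>A\<in>\<A>. modulus_density_open \<gamma> A"
  then have sets: "A \<in> sets lebesgue" if "A \<in> \<A>" for A
    using that by (auto simp: modulus_density_open_def)
  have U: "\<Union>\<A> \<in> sets lebesgue"
  proof (rule sets_lebesgue_Union_density[OF sets])
    fix A x and e :: real assume "A \<in> \<A>" "x \<in> A" "e > 0"
    then show "\<forall>\<^sub>F r in at_right 0. measure lebesgue (ball x r - A) \<le> e * measure lebesgue (ball x r)"
      using \<A> by (intro density_of_modulus_density_point[OF \<gamma>]) (auto simp: modulus_density_open_def)
  qed
  moreover have "\<Union>\<A> \<subseteq> modulus_density_points \<gamma> (\<Union>\<A>)"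
  proof
    fix x assume "x \<in> \<Union>\<A>"
    then obtain A where "A \<in> \<A>" "x \<in> A" by blast
    then show "x \<in> modulus_density_points \<gamma> (\<Union>\<A>)"
      using \<A> modulus_density_points_mono[OF \<gamma> Union_upper sets U]
      by (force simp: modulus_density_open_def)
  qed
  ultimately show "modulus_density_open \<gamma> (\<Union>\<A>)"
    by (simp add: modulus_density_open_def)
qed

lemma openin_modulus_density_topology:
  assumes "modulus_function \<gamma>"
  shows "openin (modulus_density_topology \<gamma>) = modulus_density_open \<gamma>"
  using istopology_modulus_density_open[OF assms] by (simp add: modulus_density_topology_def)

text \<open>At every real point the numerator of the modulus ratio is constantly \<open>\<gamma> 0 = 0\<close>.\<close>

lemma modulus_density_open_Compl_negligible:
  assumes \<gamma>: "modulus_function \<gamma>" and N: "negligible N"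
  shows "modulus_density_open \<gamma> (- N)"
proof -
  have "negligible (ball x r - - N)" for x r
    using N by (rule negligible_subset) auto
  then have "measure lebesgue (ball x r - - N) = 0" for x r
    by (rule negligible_imp_measure0)
  moreover have "\<gamma> 0 = 0"
    using \<gamma> by (simp add: modulus_function_def)
  ultimately have "x \<in> modulus_density_points \<gamma> (- N)" for x
    unfolding mem_modulus_density_points_iff by simp
  moreover have "- N \<in> sets lebesgue"
    using negligible_imp_sets[OF N] by (simp add: Compl_in_sets_lebesgue)
  ultimately show ?thesis
    by (auto simp: modulus_density_open_def)
qed

lemma not_modulus_density_open_singleton:
  assumes \<gamma>: "modulus_function \<gamma>"
  shows "\<not> modulus_density_open \<gamma> {x}"
proof
  assume "modulus_density_open \<gamma> {x}"
  then have "x \<in> modulus_density_points \<gamma> {x}"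
    by (simp add: modulus_density_open_def)
  then have "\<forall>\<^sub>F r in at_right 0.
      measure lebesgue (ball x r - {x}) \<le> 1/2 * measure lebesgue (ball x r)"
    by (rule density_of_modulus_density_point[OF \<gamma>]) simp
  moreover have "\<forall>\<^sub>F r in at_right (0::real). r > 0"
    by (rule eventually_at_right_less)
  ultimately have "\<forall>\<^sub>F r in at_right (0::real). False"
  proof eventually_elim
    case (elim r)
    have "measure lebesgue (ball x r - {x}) = measure lebesgue (ball x r)"
      by (rule measure_Diff_null_set) auto
    with elim show False
      by (simp add: measure_ball_real)
  qed
  then show False
    by (simp add: trivial_limit_at_right_real)
qed

section \<open>Failure of first countability\<close>

text \<open>
  If \<open>x\<close> is not isolated, each member of a countable neighbourhood base at \<open>x\<close> contains a
  point other than \<open>x\<close>. The set of chosen points is countable, hence closed, so its complement is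
  a neighbourhood of \<open>x\<close>; but it includes no member of the base.
\<close>

lemma first_countable_closedin_countable_imp_openin_singleton:
  assumes "first_countable X"
    and closed: "\<And>C. \<lbrakk>countable C; C \<subseteq> topspace X\<rbrakk> \<Longrightarrow> closedin X C"
    and x: "x \<in> topspace X"
  shows "openin X {x}"
proof (rule ccontr)
  assume not_open: "\<not> openin X {x}"
  obtain \<B> where "countable \<B>" and openB: "\<And>V. V \<in> \<B> \<Longrightarrow> openin X V"
    and base: "\<And>U. \<lbrakk>openin X U; x \<in> U\<rbrakk> \<Longrightarrow> \<exists>V\<in>\<B>. x \<in> V \<and> V \<subseteq> U"
    using assms(1) x unfolding first_countable_def by meson
  have "\<exists>y. y \<in> V \<and> y \<noteq> x" if "V \<in> \<B>" "x \<in> V" for V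
  proof (rule ccontr)
    assume "\<not> ?thesis"
    then have "V = {x}" using that by blast
    then show False using openB[OF \<open>V \<in> \<B>\<close>] not_open by simp
  qed
  then obtain y where y: "\<And>V. \<lbrakk>V \<in> \<B>; x \<in> V\<rbrakk> \<Longrightarrow> y V \<in> V \<and> y V \<noteq> x"
    by metis
  define C where "C = y ` {V \<in> \<B>. x \<in> V}"
  have "countable C"
    using \<open>countable \<B>\<close> by (simp add: C_def)
  moreover have "C \<subseteq> topspace X"
    using y openB openin_subset unfolding C_def by blast
  ultimately have "openin X (topspace X - C)"
    using closed by blast
  moreover have "x \<in> topspace X - C"
    using x y by (auto simp: C_def)
  ultimately obtain V where "V \<in> \<B>" "x \<in> V" "V \<subseteq> topspace X - C"
    using base by blast
  then show False
    using y by (auto simp: C_def)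
qed

theorem corollary3:
  fixes \<gamma> :: "real \<Rightarrow> real"
  assumes "modulus_function \<gamma>"
  shows "\<not> metrizable_space (modulus_density_topology \<gamma>)"
proof
  let ?X = "modulus_density_topology \<gamma>"
  note openin = openin_modulus_density_topology[OF assms]
  assume "metrizable_space ?X"
  then have "first_countable ?X"
    by (rule metrizable_imp_first_countable)
  moreover have "openin ?X UNIV"
    using modulus_density_open_Compl_negligible[OF assms, of "{}"] by (simp add: openin)
  then have topspace: "topspace ?X = UNIV"
    using openin_subset by blast
  moreover have "closedin ?X C" if "countable C" for C
    using modulus_density_open_Compl_negligible[OF assms, of C]
      null_sets_completionI[OF countable_imp_null_set_lborel[OF that]]
    by (simp add: negligible_iff_null_sets closedin_def topspace openin Compl_eq_Diff_UNIV)
  ultimately have "openin ?X {0}"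
    by (intro first_countable_closedin_countable_imp_openin_singleton) auto
  then show False
    using not_modulus_density_open_singleton[OF assms] by (simp add: openin)
qed

end
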